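(* Suppose $k=c\log n$ for some constant $c>0$. Then, for any $\omega=\omega(n)\gg1$, as $n\to\infty$, $$\mathbb{P}\big[\mathrm{comp}_{\max}(\mathbf{C}_{n,p})\ge k\big]\to\begin{cases}0,&\text{if } p=e^{-1/c-\omega/\log n},\\ 1,&\text{if } p=e^{-1/c+\omega/\log n},\end{cases}$$ and $$\mathbb{P}\big[\mathrm{gap}_{\max}(\mathbf{C}_{n,p})\ge k\big]\to\begin{cases}1,&\text{if } q=e^{-1/c+\omega/\log n},\\ 0,&\text{if } q=e^{-1/c-\omega/\log n}.\end{cases}$$
   Context: An $n$-composition is a sequence of $n$ nonnegative integers. For $p=p(n)\in[0,1)$ and $q=1-p$, the geometric random composition $\mathbf{C}_{n,p}$ is the random $n$-composition whose terms are independent, with $\mathbb{P}[\mathbf{C}_{n,p}(i)=j]=qp^j$ for every $j\ge0$ and $i\in\{1,\dots,n\}$. (Thus $\omega$ is understood to be such that the displayed expression for $p$ or $q$ is a legitimate value, $p\in[0,1)$.) A component of a composition is a maximal run of consecutive nonzero terms; a gap is a maximal run of consecutive zero terms. $\mathrm{comp}_{\max}(C)$ and $\mathrm{gap}_{\max}(C)$ denote the length of the longest component of $C$ and of the longest gap in $C$ (taken to be $0$ if there is none). $\omega\gg1$ means $\omega(n)\to\infty$ as $n\to\infty$. *)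

theory Defs
  imports "HOL-Probability.Probability"
begin

text \<open>
  An \<open>n\<close>-composition is represented by a function \<open>C :: nat \<Rightarrow> nat\<close> of which only the terms
  \<open>C 1, \<dots>, C n\<close> are meaningful; no definition below inspects a value outside \<open>{1..n}\<close>.
\<close>

definition maximal_runs :: "nat \<Rightarrow> (nat \<Rightarrow> bool) \<Rightarrow> nat set set" where
  "maximal_runs n P =
     {{a..b} | a b. 1 \<le> a \<and> a \<le> b \<and> b \<le> n \<and> (\<forall>i\<in>{a..b}. P i) \<and>
                    (a = 1 \<or> \<not> P (a - 1)) \<and> (b = n \<or> \<not> P (b + 1))}"

definition components :: "nat \<Rightarrow> (nat \<Rightarrow> nat) \<Rightarrow> nat set set" where
  "components n C = maximal_runs n (\<lambda>i. C i \<noteq> 0)"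

definition gaps :: "nat \<Rightarrow> (nat \<Rightarrow> nat) \<Rightarrow> nat set set" where
  "gaps n C = maximal_runs n (\<lambda>i. C i = 0)"

definition comp_max :: "nat \<Rightarrow> (nat \<Rightarrow> nat) \<Rightarrow> nat" where
  "comp_max n C = Max (insert 0 (card ` components n C))"

definition gap_max :: "nat \<Rightarrow> (nat \<Rightarrow> nat) \<Rightarrow> nat" where
  "gap_max n C = Max (insert 0 (card ` gaps n C))"

text \<open>
  The library's \<^const>\<open>geometric_pmf\<close> is parametrised by the success probability, here \<open>q = 1 - p\<close>.
  It is meaningful only for \<open>0 < q \<le> 1\<close>, that is, for \<open>0 \<le> p < 1\<close>.
\<close>

definition geometric_composition :: "nat \<Rightarrow> real \<Rightarrow> (nat \<Rightarrow> nat) pmf" where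
  "geometric_composition n p = Pi_pmf {1..n} 0 (\<lambda>_. geometric_pmf (1 - p))"

lemma prob_geometric_composition_term:
  assumes "0 \<le> p" "p < 1" "i \<in> {1..n}"
  shows "measure_pmf.prob (geometric_composition n p) {C. C i = j} = (1 - p) * p ^ j"
proof -
  have "map_pmf (\<lambda>C. C i) (geometric_composition n p) = geometric_pmf (1 - p)"
    unfolding geometric_composition_def using assms(3) by (subst Pi_pmf_component) auto
  then have "pmf (map_pmf (\<lambda>C. C i) (geometric_composition n p)) j = (1 - p) * p ^ j"
    using assms by (simp add: mult.commute)
  then show ?thesis
    by (simp add: pmf_map vimage_def)
qed

lemma indep_vars_geometric_composition:
  "prob_space.indep_vars (measure_pmf (geometric_composition n p))
     (\<lambda>_. count_space UNIV) (\<lambda>i C. C i) {1..n}"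
  unfolding geometric_composition_def by (rule indep_vars_Pi_pmf) simp

end

theory Submission
  imports Defs "HOL-Real_Asymp.Real_Asymp"
begin

text \<open>
  Call position \<open>i\<close> of a composition a hit if its term lies in a fixed set \<open>S\<close> of values: the nonzero
  values for components, \<open>{0}\<close> for gaps. Hits at different positions are independent and have
  the same probability \<open>r\<close>, which is \<open>p\<close> in the first case and \<open>q\<close> in the second. The
  longest maximal run of hits has length at least \<open>k\<close> iff some window of \<open>m = \<lceil>k\<rceil>\<close>
  consecutive positions consists of hits only (\<open>longest_maximal_run_ge_iff\<close>), so both halves of the
  theorem are instances of one threshold phenomenon for runs in independent trials. With
  \<open>k = c log n\<close> and \<open>r = e\<^bsup>-1/c \<plusminus> \<omega>/log n\<^esup>\<close> one has \<open>n r\<^sup>k = e\<^bsup>\<plusminus>c\<omega>\<^esup>\<close>, and replacing \<open>k\<close> by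
  \<open>m < k + 1\<close> costs at most a factor \<open>r\<close>.

  Below the threshold, at most \<open>n + 1\<close> windows each succeed with probability \<open>r\<^sup>m\<close>, and the
  union bound (\<open>prob_has_run_le\<close>) gives \<open>O(e\<^bsup>-c\<omega>\<^esup>)\<close>.

  Above the threshold two lower bounds are combined (\<open>prob_has_run_ge\<close>). The first one replaces
  the usual second moment computation. Let \<open>A(N)\<close> be the probability that no window inside
  \<open>{1..N}\<close> succeeds. If \<open>N - m\<close> positions are free of a successful window, then comes a miss and
  then \<open>m\<close> hits, the first successful window ends exactly at position \<open>N + 1\<close>; hence
  \<open>A(N + 1) \<le> A(N) - (1 - r) r\<^sup>m A(N - m) \<le> (1 - (1 - r) r\<^sup>m) A(N)\<close>, the last step because \<open>A\<close>
  is nonincreasing. Thus \<open>A(n) \<le> exp(-(n - m)(1 - r) r\<^sup>m)\<close>, which tends to \<open>0\<close> as long as \<open>1 - r\<close>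
  stays away from \<open>0\<close>. This bound is too weak when \<open>r\<close> is close to \<open>1\<close>, because windows then
  succeed in long clusters and few clusters start afresh. In that range it suffices to look at
  the roughly \<open>n / m\<close> disjoint blocks of length \<open>m\<close>: if \<open>r > e\<^bsup>-1/(2c)\<^esup>\<close>, then \<open>r\<^sup>m\<close> is at least of
  order \<open>n\<^bsup>-1/2\<^esup>\<close>, so \<open>(n / m) r\<^sup>m\<close> tends to infinity. The blocks alone would not do for all \<open>r\<close>:
  they lose a factor \<open>m\<close>, which a slowly growing \<open>\<omega>\<close> cannot compensate.
\<close>

section \<open>Independent coordinates\<close>

text \<open>
  Conditions \<open>E\<close> and \<open>F\<close> say that membership in the two events is decided by the coordinates in
  \<open>A\<close> and in \<open>I - A\<close>. Splitting the product distribution accordingly turns \<open>E \<inter> F\<close> into a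
  rectangle.
\<close>

lemma prob_Pi_pmf_Int_disjoint_coordinates:
  assumes "finite I" "A \<subseteq> I"
    and E: "\<And>f g. (\<And>i. i \<in> A \<Longrightarrow> f i = g i) \<Longrightarrow> f \<in> E \<Longrightarrow> g \<in> E"
    and F: "\<And>f g. (\<And>i. i \<in> I - A \<Longrightarrow> f i = g i) \<Longrightarrow> f \<in> F \<Longrightarrow> g \<in> F"
  shows "measure_pmf.prob (Pi_pmf I d p) (E \<inter> F) =
         measure_pmf.prob (Pi_pmf I d p) E * measure_pmf.prob (Pi_pmf I d p) F"
proof -
  define P where "P = Pi_pmf A d p"
  define Q where "Q = Pi_pmf (I - A) d p"
  define glue :: "('a \<Rightarrow> 'b) \<times> ('a \<Rightarrow> 'b) \<Rightarrow> 'a \<Rightarrow> 'b"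
    where "glue = (\<lambda>(f, g) i. if i \<in> A then f i else g i)"
  have "finite A" using assms(1,2) by (rule finite_subset[rotated])
  have split: "Pi_pmf I d p = map_pmf glue (pair_pmf P Q)"
    using Pi_pmf_union[of A "I - A" d p] \<open>finite A\<close> assms(1,2)
    by (simp add: P_def Q_def glue_def Un_absorb1)
  have rect: "measure_pmf.prob (pair_pmf P Q) (U \<times> V) =
              measure_pmf.prob P U * measure_pmf.prob Q V" for U V
  proof -
    \<comment> \<open>The product rule for rectangles is stated for countable sides; intersecting with the
      supports, which are countable, makes it applicable.\<close>
    have "measure_pmf.prob (pair_pmf P Q) (U \<times> V) =
          measure_pmf.prob (pair_pmf P Q) ((U \<inter> set_pmf P) \<times> (V \<inter> set_pmf Q))"
      by (subst measure_Int_set_pmf[symmetric]) (auto intro!: arg_cong[where f = "measure_pmf.prob _"])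
    also have "\<dots> = measure_pmf.prob P U * measure_pmf.prob Q V"
      by (subst measure_pmf_prob_product) (auto simp: measure_Int_set_pmf)
    finally show ?thesis .
  qed
  have glueE: "glue (f, g) \<in> E \<longleftrightarrow> f \<in> E" for f g
    using E[of "glue (f, g)" f] E[of f "glue (f, g)"] by (auto simp: glue_def)
  have glueF: "glue (f, g) \<in> F \<longleftrightarrow> g \<in> F" for f g
    using F[of "glue (f, g)" g] F[of g "glue (f, g)"] by (auto simp: glue_def)
  have "glue -` (E \<inter> F) = E \<times> F" "glue -` E = E \<times> UNIV" "glue -` F = UNIV \<times> F"
    using glueE glueF by auto
  then show ?thesis
    by (simp add: split rect)
qed

lemma prob_Pi_pmf_coordinates_in:
  assumes "finite I" "W \<subseteq> I"
  shows "measure_pmf.prob (Pi_pmf I d p) {C. \<forall>i\<in>W. C i \<in> B i} =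
         (\<Prod>i\<in>W. measure_pmf.prob (p i) (B i))"
proof -
  have "{C. \<forall>i\<in>W. C i \<in> B i} = Pi I (\<lambda>i. if i \<in> W then B i else UNIV)"
    using assms(2) by (auto simp: Pi_def)
  then have "measure_pmf.prob (Pi_pmf I d p) {C. \<forall>i\<in>W. C i \<in> B i} =
             (\<Prod>i\<in>I. if i \<in> W then measure_pmf.prob (p i) (B i) else 1)"
    using assms(1) by (simp add: measure_Pi_pmf_Pi if_distrib if_distribR cong: if_cong)
  also have "\<dots> = (\<Prod>i\<in>W. measure_pmf.prob (p i) (B i))"
    using assms by (subst prod.inter_restrict[symmetric]) (auto simp: Int_absorb1)
  finally show ?thesis .
qed

section \<open>Runs and maximal runs\<close>

definition has_run :: "nat \<Rightarrow> nat \<Rightarrow> (nat \<Rightarrow> bool) \<Rightarrow> bool" where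
  "has_run n m P \<longleftrightarrow> (\<exists>a. a + m \<le> n \<and> (\<forall>i\<in>{a<..a + m}. P i))"

lemma has_run_cong:
  assumes "\<And>i. i \<in> {1..n} \<Longrightarrow> P i = Q i" "has_run n m P"
  shows "has_run n m Q"
proof -
  from assms(2) obtain a where a: "a + m \<le> n" "\<forall>i\<in>{a<..a + m}. P i"
    unfolding has_run_def by blast
  have "Q i" if "i \<in> {a<..a + m}" for i
    using a assms(1)[of i] that by auto
  with a(1) show ?thesis unfolding has_run_def by blast
qed

text \<open>
  A run is extended to both sides as far as possible: \<open>A\<close> collects the admissible left ends and \<open>B\<close>
  the admissible right ends, and the extreme ones bound a maximal run.
\<close>

lemma ex_maximal_run_superset:
  assumes "1 \<le> s" "s \<le> t" "t \<le> n" "\<forall>i\<in>{s..t}. P i"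
  shows "\<exists>R\<in>maximal_runs n P. {s..t} \<subseteq> R"
proof -
  define A where "A = {a. 1 \<le> a \<and> a \<le> s \<and> (\<forall>i\<in>{a..t}. P i)}"
  define B where "B = {b. t \<le> b \<and> b \<le> n \<and> (\<forall>i\<in>{s..b}. P i)}"
  have "finite A" "finite B" by (auto simp: A_def B_def)
  moreover have "s \<in> A" "t \<in> B" using assms by (auto simp: A_def B_def)
  ultimately have "Min A \<in> A" "Max B \<in> B" by (auto intro: Min_in Max_in)
  moreover have "\<And>x. x \<in> A \<Longrightarrow> Min A \<le> x" "\<And>x. x \<in> B \<Longrightarrow> x \<le> Max B"
    using \<open>finite A\<close> \<open>finite B\<close> by auto
  ultimately obtain a b where "a \<in> A" "b \<in> B"
    and min: "\<And>x. x \<in> A \<Longrightarrow> a \<le> x" and max: "\<And>x. x \<in> B \<Longrightarrow> x \<le> b" by blast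
  have a: "1 \<le> a" "a \<le> s" "\<forall>i\<in>{a..t}. P i" using \<open>a \<in> A\<close> unfolding A_def by blast+
  have b: "t \<le> b" "b \<le> n" "\<forall>i\<in>{s..b}. P i" using \<open>b \<in> B\<close> unfolding B_def by blast+
  have "\<not> P (a - 1)" if "a \<noteq> 1"
  proof
    assume "P (a - 1)"
    moreover have "i = a - 1 \<or> i \<in> {a..t}" if "i \<in> {a - 1..t}" for i using that by auto
    ultimately have "\<forall>i\<in>{a - 1..t}. P i" using a(3) by blast
    moreover have "1 \<le> a - 1" "a - 1 \<le> s" using a(1,2) \<open>a \<noteq> 1\<close> by auto
    ultimately have "a - 1 \<in> A" unfolding A_def by blast
    then show False using min[of "a - 1"] a(1) by simp
  qed
  moreover have "\<not> P (b + 1)" if "b \<noteq> n"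
  proof
    assume "P (b + 1)"
    moreover have "i = b + 1 \<or> i \<in> {s..b}" if "i \<in> {s..b + 1}" for i using that by auto
    ultimately have "\<forall>i\<in>{s..b + 1}. P i" using b(3) by blast
    then have "b + 1 \<in> B" using b \<open>b \<noteq> n\<close> by (simp add: B_def)
    then show False using max[of "b + 1"] by simp
  qed
  moreover have "P i" if "i \<in> {a..b}" for i
    using a b that assms(2) by (cases "i \<le> t") auto
  moreover have "a \<le> b" using a b assms by simp
  ultimately have "{a..b} \<in> maximal_runs n P"
    unfolding maximal_runs_def using a(1) b(2) by blast
  moreover have "{s..t} \<subseteq> {a..b}" using a b by simp
  ultimately show ?thesis by blast
qed

lemma longest_maximal_run_ge_iff:
  "x \<le> real (Max (insert 0 (card ` maximal_runs n P))) \<longleftrightarrow> has_run n (nat \<lceil>x\<rceil>) P"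
proof (cases "0 < x")
  case False
  \<comment> \<open>The left side holds because of the outer \<open>0\<close>, the right side because the empty window is a run.\<close>
  then have "nat \<lceil>x\<rceil> = 0" by simp
  moreover have "has_run n 0 P" by (auto simp: has_run_def)
  ultimately show ?thesis using False by simp
next
  case True
  define m where "m = nat \<lceil>x\<rceil>"
  have "m \<ge> 1" using True unfolding m_def by linarith
  have "maximal_runs n P \<subseteq> Pow {1..n}" by (auto simp: maximal_runs_def)
  then have fin: "finite (maximal_runs n P)" by (rule finite_subset) simp
  have "x \<le> real (Max (insert 0 (card ` maximal_runs n P))) \<longleftrightarrow>
        m \<le> Max (insert 0 (card ` maximal_runs n P))"
    unfolding m_def by (simp add: nat_le_iff ceiling_le_iff)
  also have "\<dots> \<longleftrightarrow> (\<exists>R\<in>maximal_runs n P. m \<le> card R)"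
    using fin \<open>m \<ge> 1\<close> by (subst Max_ge_iff) auto
  also have "\<dots> \<longleftrightarrow> has_run n m P"
  proof
    assume "\<exists>R\<in>maximal_runs n P. m \<le> card R"
    then obtain a b where ab: "1 \<le> a" "a \<le> b" "b \<le> n" "\<forall>i\<in>{a..b}. P i" "m \<le> card {a..b}"
      unfolding maximal_runs_def by blast
    then have "a - 1 + m \<le> n" "{a - 1<..a - 1 + m} \<subseteq> {a..b}" by auto
    with ab(4) show "has_run n m P"
      unfolding has_run_def by blast
  next
    assume "has_run n m P"
    then obtain a where a: "a + m \<le> n" "\<forall>i\<in>{a<..a + m}. P i"
      unfolding has_run_def by blast
    obtain R where R: "R \<in> maximal_runs n P" "{a + 1..a + m} \<subseteq> R"
      using ex_maximal_run_superset[of "a + 1" "a + m" n P] a \<open>m \<ge> 1\<close> by auto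
    have "finite R" using R(1) by (auto simp: maximal_runs_def)
    then have "card {a + 1..a + m} \<le> card R" using R(2) by (rule card_mono)
    with R(1) show "\<exists>R\<in>maximal_runs n P. m \<le> card R" by auto
  qed
  finally show ?thesis by (simp add: m_def)
qed

section \<open>Bounds for the probability of a run\<close>

context
  fixes \<mu> :: "'b pmf" and S :: "'b set" and d :: 'b and r :: real and n m :: nat
    and M :: "(nat \<Rightarrow> 'b) pmf"
  defines "r \<equiv> measure_pmf.prob \<mu> S"
    and "M \<equiv> Pi_pmf {1..n} d (\<lambda>_. \<mu>)"
begin

text \<open>This is the union bound over the left ends of the windows.\<close>

lemma prob_has_run_le:
  "measure_pmf.prob M {C. has_run n m (\<lambda>i. C i \<in> S)} \<le> (n + 1) * r ^ m"
proof -
  define W where "W a = {C :: nat \<Rightarrow> 'b. \<forall>i\<in>{a<..a + m}. C i \<in> S}" for a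
  have "measure_pmf.prob M {C. has_run n m (\<lambda>i. C i \<in> S)}
        = measure_pmf.prob M (\<Union>a\<in>{a. a + m \<le> n}. W a)"
    by (rule arg_cong[where f = "measure_pmf.prob M"]) (auto simp: has_run_def W_def)
  also have "\<dots> \<le> (\<Sum>a\<in>{a. a + m \<le> n}. measure_pmf.prob M (W a))"
    by (rule measure_pmf.finite_measure_subadditive_finite) (auto intro: finite_subset[of _ "{..n}"])
  also have "\<dots> = (\<Sum>a\<in>{a. a + m \<le> n}. r ^ m)"
    unfolding M_def W_def by (intro sum.cong refl, subst prob_Pi_pmf_coordinates_in) (auto simp: r_def)
  also have "\<dots> \<le> (\<Sum>a\<in>{..n}. r ^ m)"
    by (rule sum_mono2) (auto simp: r_def)
  finally show ?thesis by simp
qed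

definition no_run :: "nat \<Rightarrow> real" where
  "no_run N = measure_pmf.prob M {C. \<not> has_run N m (\<lambda>i. C i \<in> S)}"

text \<open>
  The event subtracted on the right is that no run lies in the first \<open>N - m\<close> positions, that the next
  position is a miss, and that the \<open>m\<close> positions after it, up to \<open>Suc N\<close>, are hits. The miss
  separates the two parts, so no run lies in \<open>{1..N}\<close>, while one lies in \<open>{1..Suc N}\<close>.
\<close>

lemma no_run_Suc_le:
  assumes "m \<ge> 1" "m \<le> N" "N < n"
  shows "no_run (Suc N) \<le> no_run N - (1 - r) * r ^ m * no_run (N - m)"
proof -
  define a where "a = N - m"
  have N: "N = a + m" using assms by (simp add: a_def)
  define E where "E = {C :: nat \<Rightarrow> 'b. \<not> has_run a m (\<lambda>i. C i \<in> S)}"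
  define F where
    "F = {C :: nat \<Rightarrow> 'b. \<forall>i\<in>{a<..Suc N}. C i \<in> (if i = Suc a then - S else S)}"
  have "measure_pmf.prob M F =
        (\<Prod>i\<in>{a<..Suc N}. measure_pmf.prob \<mu> (if i = Suc a then - S else S))"
    unfolding M_def F_def using assms by (intro prob_Pi_pmf_coordinates_in) auto
  also have "{a<..Suc N} = insert (Suc a) {Suc a<..Suc N}" by (auto simp: N)
  also have "(\<Prod>i\<in>\<dots>. measure_pmf.prob \<mu> (if i = Suc a then - S else S)) =
             measure_pmf.prob \<mu> (- S) * (\<Prod>i\<in>{Suc a<..Suc N}. measure_pmf.prob \<mu> S)"
    by (subst prod.insert) auto
  also have "\<dots> = (1 - r) * r ^ m"
    using measure_pmf.prob_compl[of S \<mu>] by (simp add: N r_def Compl_eq_Diff_UNIV)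
  finally have F: "measure_pmf.prob M F = (1 - r) * r ^ m" .
  have EF: "measure_pmf.prob M (E \<inter> F) = no_run a * ((1 - r) * r ^ m)"
    unfolding F[symmetric] no_run_def E_def[symmetric] unfolding M_def
  proof (rule prob_Pi_pmf_Int_disjoint_coordinates[where A = "{1..a}"])
    fix f g :: "nat \<Rightarrow> 'b"
    assume "\<And>i. i \<in> {1..a} \<Longrightarrow> f i = g i" "f \<in> E"
    then show "g \<in> E"
      using has_run_cong[of a "\<lambda>i. g i \<in> S" "\<lambda>i. f i \<in> S" m] by (auto simp: E_def)
  next
    fix f g :: "nat \<Rightarrow> 'b"
    assume *: "\<And>i. i \<in> {1..n} - {1..a} \<Longrightarrow> f i = g i" "f \<in> F"
    have "f i = g i" if "i \<in> {a<..Suc N}" for i using that assms by (intro *(1)) auto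
    with *(2) show "g \<in> F" by (auto simp: F_def)
  qed (use assms in \<open>auto simp: a_def\<close>)
  have disj: "\<not> has_run N m (\<lambda>i. C i \<in> S)" "has_run (Suc N) m (\<lambda>i. C i \<in> S)"
    if "C \<in> E \<inter> F" for C
  proof -
    have in_S: "C i \<in> (if i = Suc a then - S else S)" if "i \<in> {a<..Suc N}" for i
      using \<open>C \<in> E \<inter> F\<close> that by (simp add: F_def)
    have "C i \<in> S" if "i \<in> {Suc a<..Suc a + m}" for i
      using in_S[of i] that by (simp add: N)
    then show "has_run (Suc N) m (\<lambda>i. C i \<in> S)"
      unfolding has_run_def by (intro exI[of _ "Suc a"]) (simp add: N)
    have "C (Suc a) \<notin> S" using in_S[of "Suc a"] by (simp add: N)
    show "\<not> has_run N m (\<lambda>i. C i \<in> S)"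
    proof
      assume "has_run N m (\<lambda>i. C i \<in> S)"
      then obtain b where b: "b + m \<le> N" "\<forall>i\<in>{b<..b + m}. C i \<in> S"
        by (auto simp: has_run_def)
      \<comment> \<open>The window avoids the miss, and only \<open>m - 1\<close> positions remain to its right, so the
        window lies to its left.\<close>
      with \<open>C (Suc a) \<notin> S\<close> have "\<not> (b < Suc a \<and> Suc a \<le> b + m)" by auto
      with b(1) have "b + m \<le> a" by (auto simp: N)
      with b(2) have "has_run a m (\<lambda>i. C i \<in> S)" by (auto simp: has_run_def)
      with that show False by (simp add: E_def)
    qed
  qed
  have mono: "has_run (Suc N) m P" if "has_run N m P" for P
    using that by (auto simp: has_run_def intro: le_SucI)
  have "no_run (Suc N) + measure_pmf.prob M (E \<inter> F) =
        measure_pmf.prob M ({C. \<not> has_run (Suc N) m (\<lambda>i. C i \<in> S)} \<union> E \<inter> F)"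
    unfolding no_run_def by (rule measure_pmf.finite_measure_Union[symmetric]) (use disj in auto)
  also have "\<dots> \<le> no_run N"
    unfolding no_run_def using disj mono by (intro measure_pmf.finite_measure_mono) auto
  finally show ?thesis by (simp add: EF a_def mult_ac)
qed

lemma no_run_antimono: "N \<le> N' \<Longrightarrow> no_run N' \<le> no_run N"
  unfolding no_run_def
  by (intro measure_pmf.finite_measure_mono) (auto simp: has_run_def intro: order_trans)

text \<open>
  Monotonicity turns the recurrence into a one-step decay: given that no run has occurred so far, each
  further position completes the first run with probability at least \<open>(1 - r) * r ^ m\<close>.
\<close>

lemma no_run_le_hazard_power:
  assumes "m \<ge> 1" "m + j \<le> n"
  shows "no_run (m + j) \<le> (1 - (1 - r) * r ^ m) ^ j"
  using assms(2)
proof (induction j)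
  case 0
  show ?case by (simp add: no_run_def)
next
  case (Suc j)
  have r: "0 \<le> r" "r \<le> 1" by (simp_all add: r_def)
  then have h: "0 \<le> (1 - r) * r ^ m" "(1 - r) * r ^ m \<le> 1"
    by (auto intro!: mult_le_one power_le_one)
  have "no_run (m + Suc j) \<le> no_run (m + j) - (1 - r) * r ^ m * no_run j"
    using no_run_Suc_le[of "m + j"] Suc.prems assms(1) by simp
  also have "\<dots> \<le> no_run (m + j) - (1 - r) * r ^ m * no_run (m + j)"
    using h no_run_antimono[of j "m + j"] by (auto intro!: mult_left_mono)
  also have "\<dots> = (1 - (1 - r) * r ^ m) * no_run (m + j)" by (simp add: algebra_simps)
  also have "\<dots> \<le> (1 - (1 - r) * r ^ m) * (1 - (1 - r) * r ^ m) ^ j"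
    using h Suc by (intro mult_left_mono) auto
  finally show ?case by simp
qed

text \<open>If there is no run, then each of \<open>j\<close> disjoint blocks of length \<open>m\<close> contains a miss.\<close>

lemma no_run_le_block_power:
  assumes "j * m \<le> n"
  shows "no_run (j * m) \<le> (1 - r ^ m) ^ j"
  using assms
proof (induction j)
  case 0
  show ?case by (simp add: no_run_def)
next
  case (Suc j)
  define N where "N = j * m"
  have N: "N + m \<le> n" using Suc.prems by (simp add: N_def)
  define E where "E = {C :: nat \<Rightarrow> 'b. \<not> has_run N m (\<lambda>i. C i \<in> S)}"
  define F where "F = {C :: nat \<Rightarrow> 'b. \<forall>i\<in>{N<..N + m}. C i \<in> S}"
  have r: "0 \<le> r" "r \<le> 1" by (simp_all add: r_def)
  have "measure_pmf.prob M F = (\<Prod>i\<in>{N<..N + m}. measure_pmf.prob \<mu> S)"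
    unfolding M_def F_def using N by (intro prob_Pi_pmf_coordinates_in) auto
  then have F: "measure_pmf.prob M (- F) = 1 - r ^ m"
    using measure_pmf.prob_compl[of F M] by (simp add: r_def Compl_eq_Diff_UNIV)
  have "no_run (N + m) \<le> measure_pmf.prob M (E \<inter> - F)"
    unfolding no_run_def E_def F_def
    by (rule measure_pmf.finite_measure_mono) (auto simp: has_run_def intro: trans_le_add1)
  also have "\<dots> = measure_pmf.prob M E * measure_pmf.prob M (- F)"
    unfolding M_def
  proof (rule prob_Pi_pmf_Int_disjoint_coordinates[where A = "{1..N}"])
    fix f g :: "nat \<Rightarrow> 'b"
    assume "\<And>i. i \<in> {1..N} \<Longrightarrow> f i = g i" "f \<in> E"
    then show "g \<in> E"
      using has_run_cong[of N "\<lambda>i. g i \<in> S" "\<lambda>i. f i \<in> S" m] by (auto simp: E_def)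
  next
    fix f g :: "nat \<Rightarrow> 'b"
    assume *: "\<And>i. i \<in> {1..n} - {1..N} \<Longrightarrow> f i = g i" "f \<in> - F"
    have "f i = g i" if "i \<in> {N<..N + m}" for i using that N by (intro *(1)) auto
    with *(2) show "g \<in> - F" by (auto simp: F_def)
  qed (use N in auto)
  also have "\<dots> = no_run N * (1 - r ^ m)"
    by (simp only: F) (simp add: no_run_def E_def)
  also have "\<dots> \<le> (1 - r ^ m) ^ j * (1 - r ^ m)"
    using Suc r by (intro mult_right_mono) (auto simp: N_def power_le_one)
  finally show ?case by (simp add: N_def add.commute mult.commute)
qed

text \<open>
  The first bound is good when \<open>r\<close> stays away from \<open>1\<close>, the second one when \<open>r\<close> is so large that the
  loss of a factor \<open>m\<close> does not matter.
\<close>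

lemma prob_has_run_ge:
  assumes "m \<ge> 1" "m \<le> n"
  shows "measure_pmf.prob M {C. has_run n m (\<lambda>i. C i \<in> S)} \<ge>
           1 - exp (- ((real n - m) * (1 - r) * r ^ m))" (is ?hazard)
    and "measure_pmf.prob M {C. has_run n m (\<lambda>i. C i \<in> S)} \<ge>
           1 - exp (- ((real n / m - 1) * r ^ m))" (is ?blocks)
proof -
  have r: "0 \<le> r" "r \<le> 1" by (simp_all add: r_def)
  have pow: "(1 - x) ^ j \<le> exp (- (real j * x))" if "x \<le> 1" for x :: real and j
  proof -
    have "(1 - x) ^ j \<le> exp (- x) ^ j"
      using that exp_ge_add_one_self[of "- x"] by (intro power_mono) auto
    then show ?thesis by (simp add: exp_of_nat_mult[symmetric])
  qed
  have compl: "measure_pmf.prob M {C. has_run n m (\<lambda>i. C i \<in> S)} = 1 - no_run n"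
    using measure_pmf.prob_compl[of "{C. has_run n m (\<lambda>i. C i \<in> S)}" M]
    by (simp add: no_run_def Compl_eq_Diff_UNIV[symmetric] Collect_neg_eq)
  have "no_run n \<le> (1 - (1 - r) * r ^ m) ^ (n - m)"
    using no_run_le_hazard_power[of "n - m"] assms by simp
  also have "\<dots> \<le> exp (- (real (n - m) * ((1 - r) * r ^ m)))"
    using r by (intro pow mult_le_one power_le_one) auto
  finally show ?hazard
    unfolding compl using assms by (simp add: mult.assoc)
  have "real n / m < real (n div m) + 1"
    using floor_divide_of_nat_eq[of n m, where 'a = real] real_of_int_floor_add_one_gt[of "real n / m"]
    by simp
  then have "(real n / m - 1) * r ^ m \<le> real (n div m) * r ^ m"
    using r by (intro mult_right_mono) auto
  moreover have "no_run n \<le> no_run (n div m * m)"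
    by (intro no_run_antimono) simp
  moreover have "\<dots> \<le> (1 - r ^ m) ^ (n div m)"
    by (intro no_run_le_block_power) simp
  moreover have "\<dots> \<le> exp (- (real (n div m) * r ^ m))"
    using r by (intro pow power_le_one) auto
  ultimately show ?blocks
    unfolding compl by (smt (verit) exp_le_cancel_iff)
qed

end


section \<open>The threshold for runs of logarithmic length\<close>

lemma tendsto_prob_has_run_subcritical:
  fixes c :: real and r \<omega> :: "nat \<Rightarrow> real" and \<mu> :: "nat \<Rightarrow> 'b pmf"
  assumes "c > 0" and \<omega>: "filterlim \<omega> at_top sequentially"
    and r: "\<And>n. measure_pmf.prob (\<mu> n) S = r n"
    and r_eq: "\<forall>\<^sub>F n in sequentially. r n = exp (- 1 / c - \<omega> n / ln (real n))"
  shows "(\<lambda>n. measure_pmf.prob (Pi_pmf {1..n} d (\<lambda>_. \<mu> n))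
            {C. has_run n (nat \<lceil>c * ln (real n)\<rceil>) (\<lambda>i. C i \<in> S)}) \<longlonglongrightarrow> 0"
    (is "?P \<longlonglongrightarrow> 0")
proof (rule tendsto_sandwich[OF _ _ tendsto_const])
  show "(\<lambda>n. 2 * exp (- (c * \<omega> n))) \<longlonglongrightarrow> 0"
    using filterlim_tendsto_pos_mult_at_top[OF tendsto_const \<open>c > 0\<close> \<omega>]
    by (intro tendsto_mult_right_zero filterlim_compose[OF exp_at_bot])
       (simp add: filterlim_uminus_at_bot)
  show "\<forall>\<^sub>F n in sequentially. ?P n \<le> 2 * exp (- (c * \<omega> n))"
    using r_eq filterlim_at_top_dense[THEN iffD1, OF \<omega>, rule_format, of 0] eventually_gt_at_top[of 1]
  proof eventually_elim
    case (elim n)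
    define m where "m = nat \<lceil>c * ln (real n)\<rceil>"
    define x where "x = - 1 / c - \<omega> n / ln (real n)"
    have ln: "ln (real n) > 0" using elim by simp
    then have "0 < \<omega> n / ln (real n)" "- 1 / c < 0" using elim \<open>c > 0\<close> by simp_all
    then have "x \<le> 0" unfolding x_def by linarith
    have "r n ^ m = exp (real m * x)"
      using elim by (simp add: x_def exp_of_nat_mult)
    also have "real m * x \<le> c * ln (real n) * x"
      using \<open>x \<le> 0\<close> by (intro mult_right_mono_neg) (auto simp: m_def real_nat_ceiling_ge)
    also have "c * ln (real n) * x = - ln (real n) - c * \<omega> n"
      using ln \<open>c > 0\<close> by (simp add: x_def field_simps)
    also have "exp \<dots> = exp (- (c * \<omega> n)) / real n"
      using elim by (simp add: exp_diff exp_minus field_simps)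
    finally have "r n ^ m \<le> exp (- (c * \<omega> n)) / real n" by simp
    have "0 \<le> r n" by (simp flip: r)
    have "?P n \<le> real (n + 1) * r n ^ m"
      using prob_has_run_le[of n d "\<mu> n" m S] by (simp add: r m_def)
    also have "\<dots> \<le> (2 * real n) * (exp (- (c * \<omega> n)) / real n)"
      using elim \<open>r n ^ m \<le> exp (- (c * \<omega> n)) / real n\<close> \<open>0 \<le> r n\<close> by (intro mult_mono) auto
    finally show ?case using elim by simp
  qed
qed simp

text \<open>
  Here \<open>f n\<close> is a lower bound for the exponent of the first bound in \<open>prob_has_run_ge\<close> if
  \<open>r n \<le> exp (- 1 / (2 * c))\<close>, and \<open>g n\<close> one for the exponent of the second bound otherwise. The
  sequence \<open>r\<close> may alternate between the two ranges; subtracting both error terms at every \<open>n\<close> covers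
  this without passing to subsequences.
\<close>

lemma tendsto_prob_has_run_supercritical:
  fixes c :: real and r \<omega> :: "nat \<Rightarrow> real" and \<mu> :: "nat \<Rightarrow> 'b pmf"
  assumes "c > 0" and \<omega>: "filterlim \<omega> at_top sequentially"
    and r: "\<And>n. measure_pmf.prob (\<mu> n) S = r n"
    and r_eq: "\<forall>\<^sub>F n in sequentially. r n = exp (- 1 / c + \<omega> n / ln (real n))"
  shows "(\<lambda>n. measure_pmf.prob (Pi_pmf {1..n} d (\<lambda>_. \<mu> n))
            {C. has_run n (nat \<lceil>c * ln (real n)\<rceil>) (\<lambda>i. C i \<in> S)}) \<longlonglongrightarrow> 1"
    (is "?P \<longlonglongrightarrow> 1")
proof (rule tendsto_sandwich[OF _ _ _ tendsto_const])
  define \<delta> where "\<delta> = 1 - exp (- 1 / (2 * c))"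
  define f where "f n = (\<delta> / 2 * exp (- 1 / c)) * exp (c * \<omega> n)" for n
  define g where "g n = (real n / (c * ln (real n) + 1) - 1) * exp (- (c * ln (real n) + 1) / (2 * c))"
    for n
  have "\<delta> > 0" using \<open>c > 0\<close> by (simp add: \<delta>_def)
  have "filterlim f at_top sequentially"
    unfolding f_def using \<open>\<delta> > 0\<close> \<open>c > 0\<close>
    by (intro filterlim_tendsto_pos_mult_at_top[OF tendsto_const] filterlim_compose[OF exp_at_top] \<omega>)
       auto
  moreover have "filterlim g at_top sequentially"
    unfolding g_def using \<open>c > 0\<close> by real_asymp
  ultimately have "(\<lambda>n. exp (- f n)) \<longlonglongrightarrow> 0" "(\<lambda>n. exp (- g n)) \<longlonglongrightarrow> 0"
    by (auto intro!: filterlim_compose[OF exp_at_bot] simp: filterlim_uminus_at_bot)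
  then have "(\<lambda>n. 1 - exp (- f n) - exp (- g n)) \<longlonglongrightarrow> 1 - 0 - 0"
    by (intro tendsto_intros)
  then show "(\<lambda>n. 1 - exp (- f n) - exp (- g n)) \<longlonglongrightarrow> 1" by simp
  have "\<forall>\<^sub>F n in sequentially. c * ln (real n) + 1 \<le> real n / 2"
    using \<open>c > 0\<close> by real_asymp
  then show "\<forall>\<^sub>F n in sequentially. 1 - exp (- f n) - exp (- g n) \<le> ?P n"
    using r_eq filterlim_at_top_dense[THEN iffD1, OF \<omega>, rule_format, of 0] eventually_gt_at_top[of 1]
  proof eventually_elim
    case (elim n)
    define m where "m = nat \<lceil>c * ln (real n)\<rceil>"
    define x where "x = - 1 / c + \<omega> n / ln (real n)"
    have ln: "ln (real n) > 0" using elim by simp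
    then have k: "0 < c * ln (real n)" using \<open>c > 0\<close> by simp
    then have m: "1 \<le> m" "real m \<le> c * ln (real n) + 1"
      unfolding m_def by linarith+
    with elim have m_le: "m \<le> n" "real n / 2 \<le> real n - real m" by linarith+
    have r_x: "r n = exp x" using elim by (simp add: x_def)
    have r01: "0 \<le> r n" "r n \<le> 1" by (simp_all flip: r)
    then have "x \<le> 0" by (simp add: r_x)
    have "- 1 / c \<le> x" using elim ln by (simp add: x_def)
    have "exp ((c * ln (real n) + 1) * x) \<le> exp (real m * x)"
      using m(2) \<open>x \<le> 0\<close> by (simp add: mult_right_mono_neg)
    then have r_pow: "exp ((c * ln (real n) + 1) * x) \<le> r n ^ m"
      by (simp add: r_x exp_of_nat_mult)
    show ?case
    proof (cases "x \<le> - 1 / (2 * c)")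
      case True
      have "exp (c * \<omega> n) / real n * exp (- 1 / c) \<le> exp (c * \<omega> n) / real n * exp x"
        using \<open>- 1 / c \<le> x\<close> by (intro mult_left_mono) auto
      also have "\<dots> = exp (c * ln (real n) * x + x)"
      proof -
        have "c * ln (real n) * x = c * \<omega> n - ln (real n)"
          using ln \<open>c > 0\<close> by (simp add: x_def field_simps)
        then show ?thesis using elim by (simp add: exp_add exp_diff)
      qed
      also have "\<dots> \<le> r n ^ m" using r_pow by (simp add: algebra_simps)
      finally have pow: "exp (c * \<omega> n) / real n * exp (- 1 / c) \<le> r n ^ m" .
      have "\<delta> \<le> 1 - r n" using True by (simp add: \<delta>_def r_x)
      have "f n = (real n / 2) * \<delta> * (exp (c * \<omega> n) / real n * exp (- 1 / c))"
        using elim by (simp add: f_def)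
      also have "\<dots> \<le> (real n - real m) * (1 - r n) * r n ^ m"
        using m_le \<open>\<delta> \<le> 1 - r n\<close> \<open>\<delta> > 0\<close> pow by (intro mult_mono mult_nonneg_nonneg) auto
      finally have "exp (- ((real n - real m) * (1 - r n) * r n ^ m)) \<le> exp (- f n)" by simp
      moreover have "1 - exp (- ((real n - real m) * (1 - r n) * r n ^ m)) \<le> ?P n"
        using prob_has_run_ge(1)[of m n "\<mu> n" S d] m(1) m_le by (simp add: r m_def)
      ultimately show ?thesis by (smt (verit) exp_ge_zero)
    next
      case False
      have "- (c * ln (real n) + 1) / (2 * c) = (c * ln (real n) + 1) * (- 1 / (2 * c))"
        by (metis minus_mult_left mult.commute mult_1 mult_minus_right times_divide_eq_right)
      also have "\<dots> \<le> (c * ln (real n) + 1) * x"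
        using False k by (intro mult_left_mono) auto
      finally have pow: "exp (- (c * ln (real n) + 1) / (2 * c)) \<le> r n ^ m"
        using r_pow by (meson exp_le_cancel_iff order_trans)
      have "real n / (c * ln (real n) + 1) \<le> real n / m"
        using m by (intro divide_left_mono) auto
      moreover have "1 \<le> real n / m" using m(1) m_le by simp
      ultimately have "g n \<le> (real n / m - 1) * r n ^ m"
        unfolding g_def using pow by (intro mult_mono) auto
      then have "exp (- ((real n / m - 1) * r n ^ m)) \<le> exp (- g n)" by simp
      moreover have "1 - exp (- ((real n / m - 1) * r n ^ m)) \<le> ?P n"
        using prob_has_run_ge(2)[of m n "\<mu> n" S d] m(1) m_le by (simp add: r m_def)
      ultimately show ?thesis by (smt (verit) exp_ge_zero)
    qed
  qed
qed simp

section \<open>Components and gaps of geometric compositions\<close>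

lemma prob_geometric_pmf_zero_nonzero:
  assumes "0 \<le> p" "p < 1"
  shows "measure_pmf.prob (geometric_pmf (1 - p)) {0} = 1 - p"
    and "measure_pmf.prob (geometric_pmf (1 - p)) (- {0}) = p"
proof -
  show 0: "measure_pmf.prob (geometric_pmf (1 - p)) {0} = 1 - p"
    using assms by (simp add: measure_pmf_single)
  show "measure_pmf.prob (geometric_pmf (1 - p)) (- {0}) = p"
    using measure_pmf.prob_compl[of "{0}" "geometric_pmf (1 - p)"]
    by (simp add: 0 Compl_eq_Diff_UNIV)
qed

theorem proposition3p5:
  fixes c :: real and k \<omega> p q :: "nat \<Rightarrow> real"
  assumes "c > 0"
    and "\<And>n. k n = c * ln (real n)"
    and "filterlim \<omega> at_top sequentially"
    and "\<And>n. 0 \<le> p n \<and> p n < 1"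
    and "\<And>n. q n = 1 - p n"
  shows
    "((\<forall>\<^sub>F n in sequentially. p n = exp (- 1 / c - \<omega> n / ln (real n))) \<longrightarrow>
        (\<lambda>n. measure_pmf.prob (geometric_composition n (p n)) {C. real (comp_max n C) \<ge> k n})
          \<longlonglongrightarrow> 0) \<and>
     ((\<forall>\<^sub>F n in sequentially. p n = exp (- 1 / c + \<omega> n / ln (real n))) \<longrightarrow>
        (\<lambda>n. measure_pmf.prob (geometric_composition n (p n)) {C. real (comp_max n C) \<ge> k n})
          \<longlonglongrightarrow> 1) \<and>
     ((\<forall>\<^sub>F n in sequentially. q n = exp (- 1 / c + \<omega> n / ln (real n))) \<longrightarrow>
        (\<lambda>n. measure_pmf.prob (geometric_composition n (p n)) {C. real (gap_max n C) \<ge> k n})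
          \<longlonglongrightarrow> 1) \<and>
     ((\<forall>\<^sub>F n in sequentially. q n = exp (- 1 / c - \<omega> n / ln (real n))) \<longrightarrow>
        (\<lambda>n. measure_pmf.prob (geometric_composition n (p n)) {C. real (gap_max n C) \<ge> k n})
          \<longlonglongrightarrow> 0)"
proof -
  let ?run = "\<lambda>S n. measure_pmf.prob (Pi_pmf {1..n} 0 (\<lambda>_. geometric_pmf (1 - p n)))
                 {C. has_run n (nat \<lceil>c * ln (real n)\<rceil>) (\<lambda>i. C i \<in> S)}"
  have comp: "measure_pmf.prob (geometric_composition n (p n)) {C. real (comp_max n C) \<ge> k n} =
      ?run (- {0}) n"
    and gap: "measure_pmf.prob (geometric_composition n (p n)) {C. real (gap_max n C) \<ge> k n} =
      ?run {0} n" for n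
    by (simp_all add: comp_max_def gap_max_def components_def gaps_def
          longest_maximal_run_ge_iff geometric_composition_def assms(2))
  have p: "measure_pmf.prob (geometric_pmf (1 - p n)) (- {0}) = p n"
    and q: "measure_pmf.prob (geometric_pmf (1 - p n)) {0} = q n" for n
    using prob_geometric_pmf_zero_nonzero[of "p n"] assms(4,5) by simp_all
  note sub = tendsto_prob_has_run_subcritical[OF assms(1,3),
      where \<mu> = "\<lambda>n. geometric_pmf (1 - p n)" and d = 0]
  note super = tendsto_prob_has_run_supercritical[OF assms(1,3),
      where \<mu> = "\<lambda>n. geometric_pmf (1 - p n)" and d = 0]
  show ?thesis
    unfolding comp gap
    using sub[OF p] super[OF p] sub[OF q] super[OF q]
    by blast
qed

end
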